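(* Let $\beta\in(1,2)$ and $x\in[0,\frac1{\beta-1}]$. Let $(a_i)_{i\ge1}$ be the coefficient sequence of $x$ generated by Algorithm 2, i.e. $a_i=\beta T^{(i-1)}(x)-T^{(i)}(x)$ for $i\ge1$. Then $x=\sum_{i=1}^{\infty}\frac{a_i}{\beta^i}$.
   Context: Algorithm 2: for $\beta\in(1,2)$, define the map $T$ on $[0,\frac1{\beta-1}]$ by $T(y)=\beta y-1$ if $y\ge\frac1\beta$ and $T(y)=\beta y$ if $y<\frac1\beta$. Let $T^{(0)}(x)=x$ and $T^{(i)}(x)=T(T^{(i-1)}(x))$ for $i\ge1$. The coefficients are $a_i=\beta T^{(i-1)}(x)-T^{(i)}(x)\in\{0,1\}$; that is, $a_i=1$ if $T^{(i-1)}(x)\ge\frac1\beta$ and $a_i=0$ otherwise. *)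

theory Defs
  imports Complex_Main
begin

text \<open>The map is total on the reals; it is only meant on \<open>{0..1 / (\<beta> - 1)}\<close>, which it maps into
  itself when \<open>1 < \<beta> < 2\<close> (lemma \<open>T_map_mem\<close>).\<close>

definition T_map :: "real \<Rightarrow> real \<Rightarrow> real" where
  "T_map \<beta> y = (if y \<ge> 1 / \<beta> then \<beta> * y - 1 else \<beta> * y)"

text \<open>Coefficients are indexed from 1; the value at index 0 has no meaning.\<close>

definition coeff_seq :: "real \<Rightarrow> real \<Rightarrow> nat \<Rightarrow> real" where
  "coeff_seq \<beta> x i = \<beta> * (T_map \<beta> ^^ (i - 1)) x - (T_map \<beta> ^^ i) x"

lemma T_map_mem:
  assumes "1 < \<beta>" "\<beta> < 2" "y \<in> {0..1 / (\<beta> - 1)}"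
  shows "T_map \<beta> y \<in> {0..1 / (\<beta> - 1)}"
proof (cases "y \<ge> 1 / \<beta>")
  case True
  have "\<beta> * y \<le> \<beta> * (1 / (\<beta> - 1))"
    using assms by (intro mult_left_mono) auto
  also have "\<dots> = 1 / (\<beta> - 1) + 1"
    using assms by (simp add: field_simps)
  finally show ?thesis
    using True assms by (simp add: T_map_def field_simps)
next
  case False
  then have "\<beta> * y < 1"
    using assms by (simp add: field_simps)
  moreover have "1 \<le> 1 / (\<beta> - 1)"
    using assms by (simp add: field_simps)
  ultimately have "\<beta> * y \<le> 1 / (\<beta> - 1)"
    by linarith
  then show ?thesis
    using False assms by (simp add: T_map_def)
qed

lemma coeff_seq_eq_if:
  assumes "i \<ge> 1"
  shows "coeff_seq \<beta> x i = (if (T_map \<beta> ^^ (i - 1)) x \<ge> 1 / \<beta> then 1 else 0)"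
  using assms by (cases i) (auto simp: coeff_seq_def T_map_def)

end

theory Submission
  imports Defs
begin

text \<open>With \<open>u n\<close> the \<open>n\<close>-th iterate divided by \<open>\<beta> ^ n\<close>, the \<open>n\<close>-th term of the series is
  \<open>u n - u (Suc n)\<close>; the orbit stays bounded, so \<open>u\<close> tends to 0 and the series telescopes to
  \<open>u 0 = x\<close>.\<close>

lemma T_map_funpow_mem:
  assumes "1 < \<beta>" "\<beta> < 2" "x \<in> {0..1 / (\<beta> - 1)}"
  shows "(T_map \<beta> ^^ n) x \<in> {0..1 / (\<beta> - 1)}"
proof (induction n)
  case 0
  show ?case using assms(3) by simp
next
  case (Suc n)
  show ?case using T_map_mem[OF assms(1,2) Suc.IH] by simp
qed

text \<open>Squeeze: the orbit never leaves \<open>{0..1 / (\<beta> - 1)}\<close>, so each quotient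
  lies between 0 and a fixed constant over \<open>\<beta> ^ n\<close>, which vanishes because
  \<open>\<beta>\<close> exceeds 1.\<close>

lemma T_map_funpow_scaled_tendsto_0:
  assumes "1 < \<beta>" "\<beta> < 2" "x \<in> {0..1 / (\<beta> - 1)}"
  shows "(\<lambda>n. (T_map \<beta> ^^ n) x / \<beta> ^ n) \<longlonglongrightarrow> 0"
proof (rule tendsto_sandwich)
  have bounds: "0 \<le> (T_map \<beta> ^^ n) x" "(T_map \<beta> ^^ n) x \<le> 1 / (\<beta> - 1)" for n
    using T_map_funpow_mem[OF assms, of n] by simp_all
  show "\<forall>\<^sub>F n in sequentially. 0 \<le> (T_map \<beta> ^^ n) x / \<beta> ^ n"
    using bounds(1) assms(1) by (intro always_eventually allI divide_nonneg_nonneg) auto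
  show "\<forall>\<^sub>F n in sequentially. (T_map \<beta> ^^ n) x / \<beta> ^ n \<le> 1 / (\<beta> - 1) / \<beta> ^ n"
    using bounds(2) assms(1) by (intro always_eventually allI divide_right_mono) auto
  show "(\<lambda>n. 1 / (\<beta> - 1) / \<beta> ^ n) \<longlonglongrightarrow> 0"
    by (rule LIMSEQ_divide_realpow_zero[OF assms(1)])
qed simp

theorem lemma1p3:
  fixes \<beta> x :: real
  assumes "\<beta> \<in> {1<..<2}"
    and "x \<in> {0..1 / (\<beta> - 1)}"
  shows "(\<lambda>n. coeff_seq \<beta> x (Suc n) / \<beta> ^ Suc n) sums x"
proof -
  let ?u = "\<lambda>n. (T_map \<beta> ^^ n) x / \<beta> ^ n"
  have "?u \<longlonglongrightarrow> 0"
    using assms by (intro T_map_funpow_scaled_tendsto_0) auto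
  then have "(\<lambda>n. ?u n - ?u (Suc n)) sums (?u 0 - 0)"
    by (rule telescope_sums')
  \<comment> \<open>Expanding \<open>?u n\<close> by \<open>\<beta>\<close> puts both quotients over
    \<open>\<beta> ^ Suc n\<close>; the numerator is then the coefficient of index
    \<open>Suc n\<close>, whose \<open>i - 1\<close> is \<open>n\<close>.\<close>
  moreover have "?u n - ?u (Suc n) = coeff_seq \<beta> x (Suc n) / \<beta> ^ Suc n" for n
    using assms(1) by (simp add: coeff_seq_def diff_divide_distrib)
  ultimately show ?thesis
    by simp
qed

end
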